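(* Let $G=(V,E)$ be a finite, connected, undirected, unweighted graph and let $d(x,y)$ denote the shortest-path distance between $x,y\in V$. Let $t\in V$ be a target vertex and let $l_1,l_2\in V$ be landmark vertices. For $v\in V$ define $\pi_t^{DL}(v,1)=|d(v,l_1)-d(l_1,l_2)|-d(l_2,t)$, $\pi_t^{DL}(v,2)=|d(v,l_1)-d(l_2,t)|-d(l_1,l_2)$, $\pi_t^{DL}(v,3)=|d(l_1,l_2)-d(l_2,t)|-d(v,l_1)$, $\pi_t^{DL}(v,4)=|d(v,l_1)-d(l_1,t)|$, $\pi_t^{DL}(v,5)=|d(v,l_2)-d(l_2,t)|$, and, when $l_1\neq l_2$, $\pi_t^{DL}(v,6)=\dfrac{|d(v,l_1)-d(l_1,l_2)|\cdot|d(l_1,l_2)-d(l_2,t)|-d(v,l_1)\cdot d(l_2,t)}{d(l_1,l_2)}$, and let $\pi_t^{DL}(v)=\max_i \pi_t^{DL}(v,i)$, the maximum taken over those $i\in\{1,\dots,6\}$ for which $\pi_t^{DL}(v,i)$ is defined. Then $\pi_t^{DL}$ is an admissible heuristic for A*: for every $v\in V$, $\pi_t^{DL}(v)\le d(v,t)$.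
   Context: A heuristic $h$ for A* search toward target $t$ is admissible if it never overestimates the remaining distance, i.e. $h(v)\le d(v,t)$ for all vertices $v$. The function $\pi_t^{DL}$ is called the dual landmark heuristic. *)

theory Defs
  imports "Graph_Theory.Graph_Theory"
begin

text \<open>
  Undirected graphs are symmetric digraphs (locale \<open>graph\<close>), and \<open>wf_digraph.\<mu> G c u v\<close> is the
  minimal cost, as an extended real, of a walk from \<open>u\<close> to \<open>v\<close>. In an unweighted graph every
  edge costs \<open>1\<close>. The conversion to \<open>real\<close> would send the distance \<open>\<infinity>\<close> of unreachable
  pairs to \<open>0\<close>, so \<open>gdist\<close> is meaningful only in connected graphs;
  see \<open>gdist_shortest_walk\<close> below.
\<close>

definition gdist :: "('a, 'b) pre_digraph \<Rightarrow> 'a \<Rightarrow> 'a \<Rightarrow> real" where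
  "gdist G u v = real_of_ereal (wf_digraph.\<mu> G (\<lambda>_. 1) u v)"

lemma gdist_shortest_walk:
  assumes "graph G" "Digraph_Component.connected G" "u \<in> verts G" "v \<in> verts G"
  shows "\<exists>p. pre_digraph.awalk G u p v \<and> gdist G u v = real (length p)"
    and "pre_digraph.awalk G u p v \<Longrightarrow> gdist G u v \<le> real (length p)"
proof -
  interpret graph G by fact
  have sc: "strongly_connected G"
    using assms(2) sym_arcs symmetric_connected_imp_strongly_connected by blast
  have cost: "awalk_cost (\<lambda>_. 1) q = real (length q)" for q :: "'b list"
    by (induction q) auto
  have reach: "u \<rightarrow>\<^sup>*\<^bsub>G\<^esub> v"
    using sc assms(3,4) unfolding strongly_connected_def by blast
  obtain p where p: "awalk u p v" "\<mu> (\<lambda>_. 1) u v = ereal (awalk_cost (\<lambda>_. 1) p)"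
    using min_cost_awalk[OF reach, of "\<lambda>_. 1"] by (auto simp: apath_def)
  then have d: "gdist G u v = real (length p)"
    unfolding gdist_def cost by simp
  show "\<exists>p. awalk u p v \<and> gdist G u v = real (length p)"
    using p(1) d by blast
  show "gdist G u v \<le> real (length q)" if "awalk u q v" for q
    using min_cost_le_walk_cost[OF that, of "\<lambda>_. 1"] p(2) d by (simp add: cost)
qed

definition admissible :: "('a, 'b) pre_digraph \<Rightarrow> 'a \<Rightarrow> ('a \<Rightarrow> real) \<Rightarrow> bool" where
  "admissible G t h \<longleftrightarrow> (\<forall>v\<in>verts G. h v \<le> gdist G v t)"

definition dl_bound ::
    "('a, 'b) pre_digraph \<Rightarrow> 'a \<Rightarrow> 'a \<Rightarrow> 'a \<Rightarrow> 'a \<Rightarrow> nat \<Rightarrow> real" where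
  "dl_bound G l1 l2 t v i =
    (if i = 1 then \<bar>gdist G v l1 - gdist G l1 l2\<bar> - gdist G l2 t
     else if i = 2 then \<bar>gdist G v l1 - gdist G l2 t\<bar> - gdist G l1 l2
     else if i = 3 then \<bar>gdist G l1 l2 - gdist G l2 t\<bar> - gdist G v l1
     else if i = 4 then \<bar>gdist G v l1 - gdist G l1 t\<bar>
     else if i = 5 then \<bar>gdist G v l2 - gdist G l2 t\<bar>
     else (\<bar>gdist G v l1 - gdist G l1 l2\<bar> * \<bar>gdist G l1 l2 - gdist G l2 t\<bar>
           - gdist G v l1 * gdist G l2 t) / gdist G l1 l2)"

text \<open>
  The sixth bound is undefined for equal landmarks, where \<open>dl_bound\<close> would divide by \<open>0\<close>.
\<close>

definition dl_indices :: "'a \<Rightarrow> 'a \<Rightarrow> nat set" where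
  "dl_indices l1 l2 = (if l1 = l2 then {1..5} else {1..6})"

definition dual_landmark ::
    "('a, 'b) pre_digraph \<Rightarrow> 'a \<Rightarrow> 'a \<Rightarrow> 'a \<Rightarrow> 'a \<Rightarrow> real" where
  "dual_landmark G l1 l2 t v = Max (dl_bound G l1 l2 t v ` dl_indices l1 l2)"

end

theory Submission
  imports Defs
begin

text \<open>Symmetry supplies, for each arc, some arc with swapped ends; the induction appends it to
  the reversed rest of the walk, so the length is preserved.\<close>

lemma (in sym_digraph) awalk_reverse:
  "awalk u p v \<Longrightarrow> \<exists>q. awalk v q u \<and> length q = length p"
proof (induction p arbitrary: u)
  case Nil
  then show ?case by (auto simp: awalk_Nil_iff)
next
  case (Cons e p)
  then have e: "e \<in> arcs G" "u = tail G e" "awalk (head G e) p v"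
    by (auto simp: awalk_Cons_iff)
  obtain q where q: "awalk v q (head G e)" "length q = length p"
    using Cons.IH[OF e(3)] by blast
  have "(head G e, u) \<in> arcs_ends G"
    using e(1,2) sym_arcs by (auto simp: symmetric_def arcs_ends_def arc_to_ends_def elim: symE)
  then obtain f where f: "f \<in> arcs G" "tail G f = head G e" "head G f = u"
    by (auto simp: arcs_ends_def arc_to_ends_def)
  then have "awalk (head G e) [f] u"
    by (auto simp: awalk_Cons_iff awalk_Nil_iff)
  then have "awalk v (q @ [f]) u" using q(1) awalk_appendI by blast
  then show ?case using q(2) by (metis length_append_singleton length_Cons)
qed

lemma gdist_triangle:
  assumes "graph G" "Digraph_Component.connected G" "u \<in> verts G" "v \<in> verts G" "w \<in> verts G"
  shows "gdist G u w \<le> gdist G u v + gdist G v w"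
proof -
  interpret graph G by fact
  obtain p where p: "awalk u p v" "gdist G u v = real (length p)"
    using gdist_shortest_walk(1)[OF assms(1-4)] by blast
  obtain q where q: "awalk v q w" "gdist G v w = real (length q)"
    using gdist_shortest_walk(1)[OF assms(1,2,4,5)] by blast
  have "awalk u (p @ q) w" using p(1) q(1) by (rule awalk_appendI)
  from gdist_shortest_walk(2)[OF assms(1-3,5) this] show ?thesis
    using p(2) q(2) by simp
qed

text \<open>A shortest walk from \<open>v\<close> to \<open>u\<close>, reversed, competes for the
  minimum from \<open>u\<close> to \<open>v\<close>. Exchanging the endpoints then yields symmetry
  of the distance.\<close>

lemma gdist_commute_le:
  assumes "graph G" "Digraph_Component.connected G" "u \<in> verts G" "v \<in> verts G"
  shows "gdist G u v \<le> gdist G v u"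
proof -
  interpret graph G by fact
  obtain p where p: "awalk v p u" "gdist G v u = real (length p)"
    using gdist_shortest_walk(1)[OF assms(1,2,4,3)] by blast
  then obtain q where "awalk u q v" "length q = length p"
    using awalk_reverse by blast
  then show ?thesis using gdist_shortest_walk(2)[OF assms] p(2) by fastforce
qed

lemma gdist_commute:
  assumes "graph G" "Digraph_Component.connected G" "u \<in> verts G" "v \<in> verts G"
  shows "gdist G u v = gdist G v u"
  using assms by (intro antisym gdist_commute_le)

lemma gdist_nonneg:
  assumes "graph G" "Digraph_Component.connected G" "u \<in> verts G" "v \<in> verts G"
  shows "0 \<le> gdist G u v"
  using gdist_shortest_walk(1)[OF assms] by auto

text \<open>
  Ptolemy's inequality itself can fail in a graph (for instance in the 4-cycle), but its weakening
  with the two diagonals replaced by their lower bounds follows from the triangle inequality alone.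
\<close>

lemma weak_ptolemy:
  fixes a b c d :: real
  assumes "0 \<le> a" "0 \<le> b" "0 \<le> c" "0 \<le> d"
    and "a \<le> b + c + d" "b \<le> a + c + d" "c \<le> a + b + d"
  shows "\<bar>a - b\<bar> * \<bar>b - c\<bar> - a * c \<le> b * d"
proof -
  consider "a \<le> b" "c \<le> b" | "b \<le> a" "b \<le> c" | "b \<le> a" "c \<le> b" | "a \<le> b" "b \<le> c"
    by linarith
  then show ?thesis
  proof cases
    case 1
    \<comment> \<open>The terms \<open>a * c\<close> cancel on expansion, and the premise on
      \<open>b\<close> gives \<open>b - a - c \<le> d\<close>.\<close>
    then have "\<bar>a - b\<bar> * \<bar>b - c\<bar> - a * c = b * (b - a - c)" by (simp add: algebra_simps)
    also have "\<dots> \<le> b * d" using assms by (intro mult_left_mono) auto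
    finally show ?thesis .
  next
    case 2
    \<comment> \<open>With \<open>b\<close> smallest, the factors are at most \<open>a\<close> and
      \<open>c\<close>, so the left-hand side of the goal is at most 0.\<close>
    then have "\<bar>a - b\<bar> * \<bar>b - c\<bar> \<le> a * c" using assms by (intro mult_mono) auto
    moreover have "0 \<le> b * d" using assms by simp
    ultimately show ?thesis by linarith
  next
    case 3
    \<comment> \<open>Splitting off the nonnegative term \<open>2 * (c * (a - b))\<close> leaves a
      multiple of \<open>b\<close> that the premise on \<open>a\<close> controls.\<close>
    then have "\<bar>a - b\<bar> * \<bar>b - c\<bar> - a * c = b * (a - b - c) - 2 * (c * (a - b))"
      by (simp add: algebra_simps)
    moreover have "b * (a - b - c) \<le> b * d" using assms by (intro mult_left_mono) auto
    moreover have "0 \<le> c * (a - b)" using 3 assms by simp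
    ultimately show ?thesis by linarith
  next
    case 4
    \<comment> \<open>Mirror image of the previous case under exchanging \<open>a\<close> and
      \<open>c\<close>.\<close>
    then have "\<bar>a - b\<bar> * \<bar>b - c\<bar> - a * c = b * (c - a - b) - 2 * (a * (c - b))"
      by (simp add: algebra_simps)
    moreover have "b * (c - a - b) \<le> b * d" using assms by (intro mult_left_mono) auto
    moreover have "0 \<le> a * (c - b)" using 4 assms by simp
    ultimately show ?thesis by linarith
  qed
qed

theorem theorem1:
  fixes G :: "('a, 'b) pre_digraph" and t l1 l2 :: 'a
  assumes "graph G"
    and "Digraph_Component.connected G"
    and "t \<in> verts G" and "l1 \<in> verts G" and "l2 \<in> verts G"
  shows "admissible G t (dual_landmark G l1 l2 t)"
proof -
  have "dl_bound G l1 l2 t v i \<le> gdist G v t" if v: "v \<in> verts G" for v i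
  proof -
    note tri = gdist_triangle[OF assms(1,2)]
    note sym = gdist_commute[OF assms(1,2)]
    note nonneg = gdist_nonneg[OF assms(1,2)]
    let ?a = "gdist G v l1" and ?b = "gdist G l1 l2" and ?c = "gdist G l2 t" and ?d = "gdist G v t"
    \<comment> \<open>In the quadrilateral \<open>v\<close>, \<open>l1\<close>, \<open>l2\<close>,
      \<open>t\<close> with sides \<open>?a\<close>, \<open>?b\<close>, \<open>?c\<close>,
      \<open>?d\<close>, these are the diagonals; \<open>x\<close>, \<open>y\<close>,
      \<open>z\<close> below collect inequalities of three of its triangles.\<close>
    let ?x = "gdist G v l2" and ?y = "gdist G l1 t"
    have x: "?x \<le> ?a + ?b" "?a \<le> ?x + ?b" "?b \<le> ?a + ?x"
      using tri[of v l1 l2] tri[of v l2 l1] tri[of l1 v l2] sym[of l1 l2] sym[of l1 v] v assms(3-5)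
      by auto
    have y: "?d \<le> ?a + ?y" "?a \<le> ?d + ?y" "?y \<le> ?a + ?d"
      using tri[of v l1 t] tri[of v t l1] tri[of l1 v t] sym[of l1 t] sym[of l1 v] v assms(3-5)
      by auto
    have z: "?d \<le> ?x + ?c" "?x \<le> ?d + ?c" "?c \<le> ?x + ?d"
      using tri[of v l2 t] tri[of v t l2] tri[of l2 v t] sym[of l2 t] sym[of l2 v] v assms(3-5)
      by auto
    \<comment> \<open>The quadrilateral premises arise by chaining through \<open>?x\<close>, e.g.
      \<open>?a \<le> ?x + ?b \<le> ?d + ?c + ?b\<close>.\<close>
    have "\<bar>?a - ?b\<bar> * \<bar>?b - ?c\<bar> - ?a * ?c \<le> ?b * ?d"
      using x y z nonneg v assms(3-5) by (intro weak_ptolemy) auto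
    then have "(\<bar>?a - ?b\<bar> * \<bar>?b - ?c\<bar> - ?a * ?c) / ?b \<le> ?d"
      \<comment> \<open>If \<open>?b = 0\<close>, the quotient is 0 by the convention for division
        by zero, and \<open>?d\<close> is nonnegative.\<close>
      using nonneg[of l1 l2] nonneg[of v t] v assms(3-5)
      by (cases "?b = 0") (auto simp: divide_le_eq mult.commute)
    \<comment> \<open>Bounds 1 to 3 are quadrilateral inequalities, again through \<open>?x\<close>;
      bounds 4 and 5 are the triangle inequalities in \<open>y\<close> and \<open>z\<close>.\<close>
    then show ?thesis unfolding dl_bound_def using x y z by auto
  qed
  then show ?thesis
    unfolding admissible_def dual_landmark_def dl_indices_def by auto
qed

end
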